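(* Let $(X_n)_{n\ge 0}$ be a sequence of random vectors in $\mathbb{R}^k$ that solves, for all $n\ge 2$, the distributional recursion $$X_n\stackrel{d}{=}\sum_{i=1}^b A_i(I_n)X^{(i)}_{I_{n,i}}+d(I_n,Z)$$ described in the context. Assume that $X_1=0$, that there is a constant $D>0$ such that $\|d(I_n,Z)\|\le D$ almost surely for all $n$, that for all $n$ $$\sum_{i=1}^b\|A_i(I_n)\|_{\mathrm{op}}^2\preceq_{\mathrm{st}}1-U(1-U),$$ where $U$ is uniformly distributed on $[0,1]$, and that $\|A_i(I_n)\|_{\mathrm{op}}\le 1$ almost surely for all $i\in\{1,\ldots,b\}$ and all $n$. Let $\gamma\approx 2.0047$ be the positive solution of $12/7=e^{2/\gamma}-2/\gamma$, let $L_0\approx 5.0177$ be the largest root of $e^L=6L^2$, and let $C:=48D/\gamma+D\sqrt{48(48/\gamma^2-5)}$. Then for all $t>0$, all $n\in\mathbb{N}$ and any component $X_{n,j}$ of $X_n$ ($j\in\{1,\ldots,k\}$), $$P(X_{n,j}>t)\le\begin{cases} \exp\left(-\frac{t^2}{10\gamma^2D^2}\right),&\text{if }0\le t\le 5\gamma D,\\ \exp\left(\frac52-\frac{t}{\gamma D}\right),&\text{if }5\gamma D<t\le C,\\ \exp\left(-\frac{t^2}{96D^2}\right),&\text{if }C<t\le 48DL_0,\\ \exp\left(24L_0^2-\frac{L_0}{D}t\right),&\text{if }48DL_0<t\le 4De^{L_0},\\ \exp\left(\frac tD-\frac tD\log\left(\frac{t}{4D}\right)\right),&\text{if }4De^{L_0}<t.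 \end{cases}$$ The same bounds hold for the left tail $P(X_{n,j}<-t)$.
   Context: Setting of the recursion: $b,k\ge 1$ are integers; $d:\mathbb{R}^b\times\mathbb{R}^b\to\mathbb{R}^k$ and $A_i:\mathbb{R}^b\to\mathbb{R}^{k\times k}$ ($1\le i\le b$) are deterministic (measurable) functions; $I_n=(I_{n,1},\ldots,I_{n,b})$ is a random vector with values in $\{0,\ldots,n-1\}^b$; $Z$ is a random vector in $\mathbb{R}_{\ge0}^b$; $E[d(I_n,Z)]=0$ for all $n\ge2$; for each $i$ and $m$, $X_m^{(i)}$ has the same distribution as $X_m$; and the families $(X_m^{(1)})_m,\ldots,(X_m^{(b)})_m$, $I_n$, $Z$ are independent. $\stackrel{d}{=}$ denotes equality in distribution, $\|\cdot\|$ is the Euclidean norm, $\|\cdot\|_{\mathrm{op}}$ the corresponding operator norm of matrices, and $\preceq_{\mathrm{st}}$ the usual stochastic order of real random variables ($X\preceq_{\mathrm{st}}Y$ iff $P(X>x)\le P(Y>x)$ for all $x$). The assumptions on $I_n$ concern $n\ge 2$. $\mathbb{N}=\{1,2,\ldots\}$.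
   Formalization: The formal theorem additionally assumes that X_0 = 0 almost surely or that, for all n ≥ 2, almost surely no I_{n,i} equals 0; without a condition on X_0 the claim fails (b=k=1, d=0, A_1=√3/2, I_2=0 makes X_2 distributed as (√3/2)X_0, which is arbitrary). *)

theory Defs
  imports "HOL-Probability.Probability"
begin

definition real_vec :: "nat ^ 'b \<Rightarrow> real ^ 'b" where
  "real_vec v = (\<chi> i. real (v $ i))"

definition op_norm :: "real ^ 'k ^ 'k \<Rightarrow> real" where
  "op_norm B = onorm ((*v) B)"

text \<open>The usual stochastic order. The two random variables may live on different spaces,
  since only their laws matter.\<close>

definition stoch_le :: "'a measure \<Rightarrow> ('a \<Rightarrow> real) \<Rightarrow> 'c measure \<Rightarrow> ('c \<Rightarrow> real) \<Rightarrow> bool" where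
  "stoch_le M X N Y \<longleftrightarrow>
     (\<forall>x. measure M {\<omega> \<in> space M. X \<omega> > x} \<le> measure N {\<omega> \<in> space N. Y \<omega> > x})"

definition eq_in_distr ::
  "'a measure \<Rightarrow> ('a \<Rightarrow> 'v::topological_space) \<Rightarrow> ('a \<Rightarrow> 'v) \<Rightarrow> bool" where
  "eq_in_distr M X Y \<longleftrightarrow>
     X \<in> borel_measurable M \<and> Y \<in> borel_measurable M \<and> distr M borel X = distr M borel Y"

text \<open>The \<open>b + 2\<close> independent objects on the right-hand side of the recursion take values in
  different types, so \<open>indep_vars\<close> does not apply directly; their independence is that of the
  \<open>\<sigma>\<close>-algebras they generate. A whole family \<open>(X\<^sub>m\<^sup>i)\<^sub>m\<close> counts as a single object: nothing is
  required about the dependence between its members.\<close>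

datatype 'b component = Copy 'b | Index | Noise

definition generated_events ::
  "'a measure \<Rightarrow> ('b \<Rightarrow> nat \<Rightarrow> 'a \<Rightarrow> real ^ 'k) \<Rightarrow> ('a \<Rightarrow> nat ^ 'b) \<Rightarrow> ('a \<Rightarrow> real ^ 'b)
   \<Rightarrow> 'b component \<Rightarrow> 'a set set" where
  "generated_events M Xc J Z c = (case c of
     Copy i \<Rightarrow> {(\<lambda>\<omega> m. Xc i m \<omega>) -` B \<inter> space M | B. B \<in> sets (PiM UNIV (\<lambda>_. borel))}
   | Index \<Rightarrow> {J -` B \<inter> space M | B. B \<in> sets (count_space UNIV)}
   | Noise \<Rightarrow> {Z -` B \<inter> space M | B. B \<in> sets borel})"

definition tail_bound :: "real \<Rightarrow> real \<Rightarrow> real \<Rightarrow> real \<Rightarrow> real" where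
  "tail_bound \<gamma> L0 D t =
    (let C = 48 * D / \<gamma> + D * sqrt (48 * (48 / \<gamma>\<^sup>2 - 5)) in
     if t \<le> 5 * \<gamma> * D then exp (- (t\<^sup>2 / (10 * \<gamma>\<^sup>2 * D\<^sup>2)))
     else if t \<le> C then exp (5 / 2 - t / (\<gamma> * D))
     else if t \<le> 48 * D * L0 then exp (- (t\<^sup>2 / (96 * D\<^sup>2)))
     else if t \<le> 4 * D * exp L0 then exp (24 * L0\<^sup>2 - L0 / D * t)
     else exp (t / D - t / D * ln (t / (4 * D))))"

end

theory Submission
  imports Defs
begin

text \<open>
  The tails are obtained by Chernoff's method from a bound on the moment generating functions,
  \<open>E[exp (s \<bullet> X\<^sub>n)] \<le> exp (f (D * norm s))\<close>, which holds for all \<open>n \<ge> 1\<close> and all \<open>s\<close> with the function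
  \<open>f = mgf_exponent \<gamma> L0\<close> that equals \<open>5 / 2 * \<gamma>\<^sup>2 * x\<^sup>2\<close> up to \<open>1 / \<gamma>\<close>, \<open>24 * x\<^sup>2\<close> from
  there up to \<open>L0\<close>, and \<open>4 * exp x\<close> beyond. Optimizing over multiples \<open>s\<close> of plus or minus a
  coordinate vector gives the five regimes (\<open>tail_bound_of_chernoff\<close>).

  The moment bound is proved by induction on \<open>n\<close>. Write \<open>W\<close> for the sum of the squared operator
  norms of the \<open>A\<^sub>i(I\<^sub>n)\<close> and \<open>\<sigma> = D * norm s\<close>. Conditionally on \<open>I\<^sub>n\<close> the copies are independent,
  and \<open>f (c * x) \<le> c\<^sup>2 * f x\<close> for \<open>0 \<le> c \<le> 1\<close> (\<open>mgf_exponent_scale\<close>), so the induction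
  hypothesis bounds the moment of the right-hand side of the recursion by
  \<open>E[exp (s \<bullet> d + f \<sigma> * W)]\<close> (\<open>mgf_recursion_step\<close>). It remains to see that
  \<open>exp (s \<bullet> d + f \<sigma> * (W - 1))\<close> has expectation at most 1: the contraction has to compensate for the
  toll (\<open>mgf_toll_step\<close>).

  By the stochastic order, \<open>E[exp (a * (W - 1))] \<le> E[exp (- a * U * (1 - U))]\<close>, which is at most both
  \<open>1 - a / 6 + a\<^sup>2 / 60\<close> and \<open>4 / a\<close>. The toll satisfies \<open>\<bar>s \<bullet> d\<bar> \<le> \<sigma>\<close> and is centered, so
  that \<open>E[exp (2 * (s \<bullet> d))] \<le> exp (2 * \<sigma>) - 2 * \<sigma>\<close>. For \<open>\<sigma> \<le> 1 / \<gamma>\<close> the last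
  expression is at most \<open>1 + 5 / 7 * (\<gamma> * \<sigma>)\<^sup>2\<close> by the choice of \<open>\<gamma>\<close>, and Cauchy--Schwarz with the
  quadratic bound for the contraction suffices. For larger \<open>\<sigma>\<close> the bound \<open>4 / a\<close> is used: with
  \<open>a = f \<sigma>\<close> the crude estimate \<open>s \<bullet> d \<le> \<sigma>\<close> leads to the condition
  \<open>4 * exp \<sigma> \<le> f \<sigma>\<close>, which for \<open>f \<sigma> = 24 * \<sigma>\<^sup>2\<close> reads \<open>exp \<sigma> \<le> 6 * \<sigma>\<^sup>2\<close> and holds
  from slightly above \<open>1 / \<gamma>\<close> up to \<open>L0\<close>; this is where \<open>L0\<close> comes from.
  Beyond \<open>L0\<close> the exponent is chosen to give equality. The short gap after \<open>1 / \<gamma>\<close> is covered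
  once more by Cauchy--Schwarz.
\<close>

section \<open>Inequalities for the exponential function\<close>

text \<open>The power series of \<open>exp x - 1 - x\<close> starts with the quadratic term, so each of its terms
  gains a factor of at most \<open>c\<^sup>2\<close>. With \<open>x = 2 / \<gamma>\<close> this turns the equation that defines \<open>\<gamma>\<close>
  into the quadratic bound \<open>exp (2 * \<sigma>) - 2 * \<sigma> \<le> 1 + 5 / 7 * (\<gamma> * \<sigma>)\<^sup>2\<close> for all
  \<open>\<sigma> \<le> 1 / \<gamma>\<close>.\<close>
lemma exp_remainder_scaling:
  fixes c x :: real
  assumes "0 \<le> c" "c \<le> 1" "0 \<le> x"
  shows "exp (c * x) - 1 - c * x \<le> c\<^sup>2 * (exp x - 1 - x)"
proof -
  let ?r = "\<lambda>y n. inverse (fact (n + 2)) *\<^sub>R (y ^ (n + 2)) :: real"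
  have S: "summable (?r y)" for y :: real
    using summable_ignore_initial_segment[OF summable_exp_generic[of y], of 2] by (simp add: field_simps)
  have R: "exp y - 1 - y = (\<Sum>n. ?r y n)" for y :: real
    using exp_first_two_terms[of y] by simp
  have "?r (c * x) n \<le> c\<^sup>2 * ?r x n" for n
  proof -
    have "c ^ n * (c\<^sup>2 * x ^ (n + 2)) \<le> 1 * (c\<^sup>2 * x ^ (n + 2))"
      using assms by (intro mult_right_mono power_le_one) auto
    then have "(c * x) ^ (n + 2) \<le> c\<^sup>2 * x ^ (n + 2)"
      by (simp only: power_mult_distrib power_add mult_ac)
    then have "inverse (fact (n + 2)) * (c * x) ^ (n + 2) \<le> inverse (fact (n + 2)) * (c\<^sup>2 * x ^ (n + 2))"
      by (rule mult_left_mono) simp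
    then show ?thesis by (simp only: real_scaleR_def mult_ac)
  qed
  then have "(\<Sum>n. ?r (c * x) n) \<le> (\<Sum>n. c\<^sup>2 * ?r x n)"
    by (intro suminf_le S summable_mult) auto
  then show ?thesis by (simp only: R suminf_mult[OF S])
qed

text \<open>The function \<open>exp x - x\<close> increases on the positive axis, and at \<open>- y\<close> it is at most its
  value at \<open>y \<ge> 0\<close> because \<open>y \<le> sinh y\<close>. It is used both for numerical estimates and as the
  pointwise bound behind the moment generating function of a bounded centered variable.\<close>
lemma exp_minus_self_mono_abs:
  fixes x r :: real
  assumes "\<bar>x\<bar> \<le> r"
  shows "exp x - x \<le> exp r - r"
proof -
  have mono: "exp y - y \<le> exp z - z" if "0 \<le> y" "y \<le> z" for y z :: real
  proof (rule DERIV_nonneg_imp_nondecreasing[of y z "\<lambda>x. exp x - x"])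
    show "y \<le> z" by fact
    fix u :: real assume "y \<le> u"
    then show "\<exists>D. ((\<lambda>x. exp x - x) has_real_derivative D) (at u) \<and> 0 \<le> D"
      using that by (intro exI[of _ "exp u - 1"]) (auto intro!: derivative_eq_intros)
  qed
  have neg: "exp (- y) + y \<le> exp y - y" if "0 \<le> y" for y :: real
  proof -
    have "exp 0 - exp (-0) - 2 * 0 \<le> exp y - exp (- y) - 2 * y"
    proof (rule DERIV_nonneg_imp_nondecreasing[of 0 y "\<lambda>x. exp x - exp (-x) - 2 * x"])
      show "0 \<le> y" by fact
      fix u :: real assume "0 \<le> u"
      \<comment> \<open>The derivative is \<open>2 * cosh u - 2\<close>.\<close>
      have "0 \<le> (exp u - 1)\<^sup>2 * exp (-u)" by simp
      also have "\<dots> = exp u + exp (-u) - 2"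
        by (simp add: power2_eq_square algebra_simps exp_minus divide_simps)
      finally show "\<exists>D. ((\<lambda>x. exp x - exp (-x) - 2 * x) has_real_derivative D) (at u) \<and> 0 \<le> D"
        by (intro exI[of _ "exp u + exp (-u) - 2"]) (auto intro!: derivative_eq_intros)
    qed
    then show ?thesis by simp
  qed
  show ?thesis
  proof (cases "0 \<le> x")
    case True then show ?thesis using mono[of x r] assms by auto
  next
    case False then show ?thesis using mono[of "-x" r] neg[of "-x"] assms by auto
  qed
qed

lemma exp_1_bounds: "exp 1 < (2719 / 1000 :: real)" "exp 1 > (2718 / 1000 :: real)"
  using e_approx_32 by (simp_all add: abs_if split: if_splits)

text \<open>Raising both sides to the power 20 reduces the claim to the bound for \<open>exp 1\<close>. The right-hand
  side is \<open>6 * (11 / 20)\<^sup>2\<close>: the point \<open>11 / 20\<close> lies just right of the smaller positive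
  root of \<open>exp x = 6 * x\<^sup>2\<close>.\<close>
lemma exp_11_20_le: "exp (11 / 20) \<le> (1815 / 1000 :: real)"
proof (rule power_le_imp_le_base[where n = 19])
  have "exp (11 / 20 :: real) ^ 20 = exp 1 ^ 11"
    by (simp flip: exp_of_nat_mult)
  also have "\<dots> \<le> (2719 / 1000) ^ 11"
    using exp_1_bounds(1) by (intro power_mono) auto
  also have "\<dots> \<le> (1815 / 1000 :: real) ^ 20"
    by (simp add: power_divide)
  finally show "exp (11 / 20 :: real) ^ Suc 19 \<le> (1815 / 1000) ^ Suc 19"
    by simp
qed simp

text \<open>Both bounds hold because \<open>exp x - x\<close> is increasing and takes values on either side of
  \<open>12 / 7\<close> at \<open>x = 9 / 10\<close> and \<open>x = 1\<close>, so that \<open>9 / 10 < 2 / \<gamma> < 1\<close>.\<close>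
lemma gamma_bounds:
  fixes \<gamma> :: real
  assumes "\<gamma> > 0" "12 / 7 = exp (2 / \<gamma>) - 2 / \<gamma>"
  shows "2 < \<gamma>" "\<gamma> < 20 / 9"
proof -
  have A: "exp 1 - 1 > (12/7 :: real)"
    using exp_1_bounds(2) by simp
  have B: "exp (9/10) - 9/10 < (12/7::real)"
  proof -
    have "exp (9/10 :: real) \<le> 261 / 100"
    proof (rule power_le_imp_le_base[where n = 9])
      have "exp (9 / 10 :: real) ^ 10 = exp 1 ^ 9"
        by (simp flip: exp_of_nat_mult)
      also have "\<dots> \<le> (2719 / 1000) ^ 9"
        using exp_1_bounds(1) by (intro power_mono) auto
      also have "\<dots> \<le> (261 / 100 :: real) ^ 10"
        by (simp add: power_divide)
      finally show "exp (9 / 10 :: real) ^ Suc 9 \<le> (261 / 100) ^ Suc 9"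
        by simp
    qed simp
    then show ?thesis by simp
  qed
  show "2 < \<gamma>"
  proof (rule ccontr)
    assume "\<not> 2 < \<gamma>"
    then have "exp 1 - 1 \<le> exp (2/\<gamma>) - 2/\<gamma>"
      using assms by (intro exp_minus_self_mono_abs) (auto simp: field_simps)
    with A assms show False by linarith
  qed
  show "\<gamma> < 20 / 9"
  proof (rule ccontr)
    assume "\<not> \<gamma> < 20 / 9"
    then have "exp (2/\<gamma>) - 2/\<gamma> \<le> exp (9/10) - 9/10"
      using assms by (intro exp_minus_self_mono_abs) (auto simp: field_simps)
    with B assms show False by linarith
  qed
qed

text \<open>The difference \<open>exp x - 6 * x\<^sup>2\<close> changes sign between 5 and 12, so there is a root in
  this interval, and \<open>L0\<close> is at least as large.\<close>
lemma L0_ge_5: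
  fixes L0 :: real
  assumes "\<And>L. exp L = 6 * L\<^sup>2 \<Longrightarrow> L \<le> L0"
  shows "5 \<le> L0"
proof -
  have "\<exists>x\<ge>5. x \<le> 12 \<and> exp x - 6 * x\<^sup>2 = (0::real)"
  proof (rule IVT')
    have "exp (5::real) = exp 1 ^ 5" by (simp flip: exp_of_nat_mult)
    also have "\<dots> \<le> (2719 / 1000) ^ 5"
      using exp_1_bounds(1) by (intro power_mono) auto
    also have "\<dots> \<le> 6 * 5\<^sup>2" by (simp add: power_divide)
    finally show "exp 5 - 6 * 5\<^sup>2 \<le> (0::real)" by simp
    have "6 * 12\<^sup>2 \<le> (2718 / 1000 :: real) ^ 12" by (simp add: power_divide)
    also have "\<dots> \<le> exp 1 ^ 12"
      using exp_1_bounds(2) by (intro power_mono) auto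
    also have "\<dots> = exp 12" by (simp flip: exp_of_nat_mult)
    finally show "0 \<le> exp 12 - 6 * (12::real)\<^sup>2" by simp
  qed (auto intro!: continuous_intros)
  then show ?thesis using assms by fastforce
qed

text \<open>In logarithmic form the claim says that \<open>x - 2 * ln x - ln 6\<close> is nonpositive. This function is
  convex, hence bounded on an interval by its values at the endpoints, which are nonpositive.\<close>
lemma exp_le_6_square:
  fixes L0 :: real
  assumes L0: "exp L0 = 6 * L0\<^sup>2" "\<And>L. exp L = 6 * L\<^sup>2 \<Longrightarrow> L \<le> L0" and x: "11 / 20 \<le> x" "x \<le> L0"
  shows "exp x \<le> 6 * x\<^sup>2"
proof -
  let ?h = "\<lambda>x. x - 2 * ln x - ln 6 :: real"
  have "5 \<le> L0" using L0_ge_5[OF L0(2)] .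
  have h_iff: "exp y \<le> 6 * y\<^sup>2 \<longleftrightarrow> ?h y \<le> 0" if "0 < y" for y :: real
  proof -
    have "exp y \<le> 6 * y\<^sup>2 \<longleftrightarrow> exp y \<le> exp (ln (6 * y\<^sup>2))" using that by simp
    also have "\<dots> \<longleftrightarrow> ?h y \<le> 0"
      unfolding exp_le_cancel_iff using that by (simp add: ln_mult ln_realpow algebra_simps)
    finally show ?thesis .
  qed
  have conv: "convex_on {0<..} ?h"
  proof (rule f''_ge0_imp_convex[where f' = "\<lambda>x. 1 - 2 / x" and f'' = "\<lambda>x. 2 / x\<^sup>2"])
    show "((\<lambda>x. x - 2 * ln x - ln 6) has_real_derivative 1 - 2 / x) (at x)" if "x \<in> {0<..}" for x :: real
      using that by (auto intro!: derivative_eq_intros)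
    show "((\<lambda>x. 1 - 2 / x) has_real_derivative 2 / x\<^sup>2) (at x)" if "x \<in> {0<..}" for x :: real
      using that by (auto intro!: derivative_eq_intros simp: power2_eq_square)
  qed auto
  have "exp (11/20) \<le> 6 * (11/20::real)\<^sup>2"
    using exp_11_20_le by (simp add: power2_eq_square)
  then have a: "?h (11/20) \<le> 0" using h_iff[of "11/20"] by simp
  have b: "?h L0 \<le> 0" using h_iff[of L0] L0(1) \<open>5 \<le> L0\<close> by simp
  have "?h x \<le> max (?h (11/20)) (?h L0)"
  proof (rule convex_on_le_max[where f = ?h])
    show "convex_on {11/20..L0} ?h"
      by (rule convex_on_subset[OF conv]) auto
  qed (use x in auto)
  then show ?thesis using a b x by (subst h_iff) auto
qed

section \<open>Stochastic order and exponential moments\<close>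

text \<open>The layer cake formula: \<open>g \<omega>\<close> is the length of the interval \<open>[0, g \<omega>)\<close>, and Fubini exchanges
  the two integrations.\<close>
lemma (in finite_measure) nn_integral_eq_tail_integral:
  assumes [measurable]: "g \<in> borel_measurable M"
  shows "(\<integral>\<^sup>+\<omega>. ennreal (g \<omega>) \<partial>M)
    = (\<integral>\<^sup>+t. indicator {0..} t * emeasure M {\<omega> \<in> space M. g \<omega> > t} \<partial>lborel)"
proof -
  interpret pair_sigma_finite M lborel
    by (simp add: pair_sigma_finite_def sigma_finite_measure_axioms sigma_finite_lborel)
  have "(\<integral>\<^sup>+\<omega>. ennreal (g \<omega>) \<partial>M) = (\<integral>\<^sup>+\<omega>. \<integral>\<^sup>+t. indicator {0..<g \<omega>} t \<partial>lborel \<partial>M)"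
  proof (intro nn_integral_cong)
    fix \<omega>
    show "ennreal (g \<omega>) = (\<integral>\<^sup>+t. indicator {0..<g \<omega>} t \<partial>lborel)"
      by (cases "0 \<le> g \<omega>") (simp_all add: ennreal_neg)
  qed
  also have "\<dots> = (\<integral>\<^sup>+\<omega>. \<integral>\<^sup>+t. (case (\<omega>, t) of (\<omega>, t) \<Rightarrow> if 0 \<le> t \<and> t < g \<omega> then 1 else 0) \<partial>lborel \<partial>M)"
    by (intro nn_integral_cong) (auto simp: indicator_def)
  also have "\<dots> = (\<integral>\<^sup>+t. \<integral>\<^sup>+\<omega>. (case (\<omega>, t) of (\<omega>, t) \<Rightarrow> if 0 \<le> t \<and> t < g \<omega> then 1 else 0) \<partial>M \<partial>lborel)"
    by (rule Fubini'[symmetric]) measurable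
  also have "\<dots> = (\<integral>\<^sup>+t. indicator {0..} t * emeasure M {\<omega> \<in> space M. g \<omega> > t} \<partial>lborel)"
  proof (intro nn_integral_cong)
    fix t :: real
    have "(\<integral>\<^sup>+\<omega>. (case (\<omega>, t) of (\<omega>, t) \<Rightarrow> if 0 \<le> t \<and> t < g \<omega> then 1 else 0) \<partial>M)
      = (\<integral>\<^sup>+\<omega>. indicator {0..} t * indicator {\<omega> \<in> space M. g \<omega> > t} \<omega> \<partial>M)"
      by (intro nn_integral_cong) (auto simp: indicator_def)
    also have "\<dots> = indicator {0..} t * emeasure M {\<omega> \<in> space M. g \<omega> > t}"
      by (subst nn_integral_cmult) auto
    finally show "(\<integral>\<^sup>+\<omega>. (case (\<omega>, t) of (\<omega>, t) \<Rightarrow> if 0 \<le> t \<and> t < g \<omega> then 1 else 0) \<partial>M)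
      = indicator {0..} t * emeasure M {\<omega> \<in> space M. g \<omega> > t}" .
  qed
  finally show ?thesis .
qed

text \<open>Stochastic order compares tails only. By the layer cake formula it carries over to expectations
  of nonnegative increasing functions, here to \<open>exp (a * x)\<close>.\<close>
lemma stoch_le_mgf_mono:
  fixes X :: "'a \<Rightarrow> real" and Y :: "'c \<Rightarrow> real"
  assumes M: "prob_space M" and N: "prob_space N"
    and [measurable]: "X \<in> borel_measurable M" "Y \<in> borel_measurable N"
    and le: "stoch_le M X N Y" and "0 \<le> a"
  shows "(\<integral>\<^sup>+\<omega>. ennreal (exp (a * X \<omega>)) \<partial>M) \<le> (\<integral>\<^sup>+\<omega>. ennreal (exp (a * Y \<omega>)) \<partial>N)"
proof -
  interpret M: prob_space M by fact
  interpret N: prob_space N by fact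
  show ?thesis
  proof (cases "a = 0")
    case True
    then show ?thesis by (simp add: M.emeasure_space_1 N.emeasure_space_1)
  next
    case False
    with \<open>0 \<le> a\<close> have "0 < a" by simp
    have "emeasure M {\<omega> \<in> space M. exp (a * X \<omega>) > t} \<le> emeasure N {\<omega> \<in> space N. exp (a * Y \<omega>) > t}" for t
    proof (cases "0 < t")
      case True
      have iff: "t < exp (a * y) \<longleftrightarrow> ln t / a < y" for y
      proof -
        have "t < exp (a * y) \<longleftrightarrow> exp (ln t) < exp (a * y)" using True by simp
        also have "\<dots> \<longleftrightarrow> ln t / a < y"
          unfolding exp_less_cancel_iff using \<open>0 < a\<close> by (simp add: pos_divide_less_eq mult.commute)
        finally show ?thesis .
      qed
      show ?thesis
        using le unfolding stoch_le_def iff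
        by (simp add: M.emeasure_eq_measure N.emeasure_eq_measure)
    next
      case False
      then have "t < exp y" for y using exp_gt_zero[of y] by linarith
      then show ?thesis by (simp add: M.emeasure_space_1 N.emeasure_space_1)
    qed
    then show ?thesis
      by (subst (1 2) finite_measure.nn_integral_eq_tail_integral)
        (auto intro!: nn_integral_mono mult_left_mono M.finite_measure_axioms N.finite_measure_axioms)
  qed
qed

abbreviation (input) unif01 :: "real measure" where
  "unif01 \<equiv> uniform_measure lborel {0..1}"

lemma nn_integral_unif01_le:
  assumes [measurable]: "f \<in> borel_measurable borel"
    and le: "\<And>u. 0 \<le> u \<Longrightarrow> u \<le> 1 \<Longrightarrow> 0 \<le> f u \<and> f u \<le> g u"
    and g: "(g has_integral r) {0..1}"
  shows "(\<integral>\<^sup>+u. ennreal (f u) \<partial>unif01) \<le> ennreal r"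
proof -
  have "(\<integral>\<^sup>+u. ennreal (f u) \<partial>unif01) = (\<integral>\<^sup>+u. ennreal (f u) * indicator {0..1} u \<partial>lborel)"
    by (subst nn_integral_uniform_measure) (auto simp: divide_ennreal_def)
  also have "\<dots> \<le> (\<integral>\<^sup>+u. ennreal (g u) * indicator {0..1} u \<partial>lborel)"
    using le by (intro nn_integral_mono) (auto simp: indicator_def intro!: ennreal_leI)
  also have "\<dots> = ennreal r"
    using le g by (intro nn_integral_has_integral_lebesgue') force+
  finally show ?thesis .
qed

text \<open>The product of \<open>1 - x + x\<^sup>2 / 2\<close> and \<open>1 + x + x\<^sup>2 / 2\<close> is \<open>1 + x\<^sup>4 / 4\<close>, and the second
  factor is at most \<open>exp x\<close>.\<close>
lemma exp_minus_le_quadratic: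
  fixes x :: real
  assumes "0 \<le> x"
  shows "exp (- x) \<le> 1 - x + x\<^sup>2 / 2"
proof -
  have pos: "0 < 1 - x + x\<^sup>2 / 2"
    using zero_le_power2[of "x - 1"] by (simp add: power2_eq_square algebra_simps)
  have "1 \<le> 1 + x ^ 4 / 4" by simp
  also have "\<dots> = (1 - x + x\<^sup>2 / 2) * (1 + x + x\<^sup>2 / 2)"
    by (simp add: algebra_simps power2_eq_square power4_eq_xxxx)
  also have "\<dots> \<le> (1 - x + x\<^sup>2 / 2) * exp x"
    using pos exp_lower_Taylor_quadratic[OF assms] by (intro mult_left_mono) auto
  finally show ?thesis by (simp add: exp_minus field_simps)
qed

text \<open>This bound serves small \<open>a\<close>: it agrees with the left-hand side to second order at
  \<open>a = 0\<close>. The coefficients come from the first two moments of \<open>U * (1 - U)\<close>, which are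
  \<open>1 / 6\<close> and \<open>1 / 30\<close>.\<close>
lemma unif01_mgf_le_quadratic:
  assumes "0 \<le> a"
  shows "(\<integral>\<^sup>+u. ennreal (exp (- (a * (u * (1 - u))))) \<partial>unif01) \<le> ennreal (1 - a / 6 + a\<^sup>2 / 60)"
proof (rule nn_integral_unif01_le)
  let ?g = "\<lambda>u::real. 1 - a * (u * (1 - u)) + (a * (u * (1 - u)))\<^sup>2 / 2"
  let ?G = "\<lambda>u::real. u - a * (u\<^sup>2 / 2 - u ^ 3 / 3) + a\<^sup>2 / 2 * (u ^ 3 / 3 - u ^ 4 / 2 + u ^ 5 / 5)"
  have "(?g has_integral ?G 1 - ?G 0) {0..1}"
  proof (rule fundamental_theorem_of_calculus)
    fix u :: real
    show "(?G has_vector_derivative ?g u) (at u within {0..1})"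
      unfolding has_real_derivative_iff_has_vector_derivative[symmetric]
      by (auto intro!: derivative_eq_intros simp: field_simps power2_eq_square eval_nat_numeral)
  qed simp
  then show "(?g has_integral 1 - a / 6 + a\<^sup>2 / 60) {0..1}"
    by (simp add: field_simps)
  show "0 \<le> exp (- (a * (u * (1 - u)))) \<and> exp (- (a * (u * (1 - u)))) \<le> ?g u" if "0 \<le> u" "u \<le> 1" for u
    using that assms by (auto intro!: exp_minus_le_quadratic mult_nonneg_nonneg)
qed measurable

text \<open>For large \<open>a\<close> the mass sits near the two endpoints. The parabola \<open>u * (1 - u)\<close> lies above
  \<open>u / 2\<close> on the left half and above \<open>(1 - u) / 2\<close> on the right half, so the integrand is at most
  the sum of the two exponentials, each with integral at most \<open>2 / a\<close>.\<close>
lemma unif01_mgf_le_inverse: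
  assumes "0 < a"
  shows "(\<integral>\<^sup>+u. ennreal (exp (- (a * (u * (1 - u))))) \<partial>unif01) \<le> ennreal (4 / a)"
proof -
  let ?g = "\<lambda>u::real. exp (- (a / 2) * u) + exp (- (a / 2) * (1 - u))"
  let ?G = "\<lambda>u::real. - (2 / a) * exp (- (a / 2) * u) + (2 / a) * exp (- (a / 2) * (1 - u))"
  have "(\<integral>\<^sup>+u. ennreal (exp (- (a * (u * (1 - u))))) \<partial>unif01) \<le> ennreal (?G 1 - ?G 0)"
  proof (rule nn_integral_unif01_le)
    show "(?g has_integral ?G 1 - ?G 0) {0..1}"
    proof (rule fundamental_theorem_of_calculus)
      fix u :: real
      show "(?G has_vector_derivative ?g u) (at u within {0..1})"
        unfolding has_real_derivative_iff_has_vector_derivative[symmetric] using assms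
        by (auto intro!: derivative_eq_intros simp: field_simps)
    qed simp
    show "0 \<le> exp (- (a * (u * (1 - u)))) \<and> exp (- (a * (u * (1 - u)))) \<le> ?g u" if u: "0 \<le> u" "u \<le> 1" for u
    proof (cases "u \<le> 1 / 2")
      case True
      then have "u * (1 / 2) \<le> u * (1 - u)" using u by (intro mult_left_mono) auto
      from mult_left_mono[OF this, of a] have "a * (u * (1 / 2)) \<le> a * (u * (1 - u))"
        using assms by linarith
      then have "exp (- (a * (u * (1 - u)))) \<le> exp (- (a / 2) * u)"
        unfolding exp_le_cancel_iff by linarith
      then show ?thesis by (intro conjI add_increasing2 exp_ge_zero)
    next
      case False
      then have "(1 - u) * (1 / 2) \<le> (1 - u) * u" using u by (intro mult_left_mono) auto
      from mult_left_mono[OF this, of a] have "a * ((1 - u) * (1 / 2)) \<le> a * ((1 - u) * u)"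
        using assms by linarith
      then have "exp (- (a * (u * (1 - u)))) \<le> exp (- (a / 2) * (1 - u))"
        unfolding exp_le_cancel_iff mult.commute[of u] by linarith
      then show ?thesis by (intro conjI add_increasing exp_ge_zero)
    qed
  qed measurable
  also have "?G 1 - ?G 0 \<le> 4 / a"
    using assms by (simp add: field_simps)
  finally show ?thesis by (simp add: ennreal_leI)
qed

section \<open>The exponent of the moment generating function\<close>

text \<open>The induction shows that \<open>ln E[exp (s \<bullet> X\<^sub>n)]\<close> is at most this function at \<open>x = D * norm s\<close>.
  On the first piece the centering of the toll allows a small constant. Beyond it the toll is
  essentially bounded by its maximum, and a quadratic exponent suffices as long as
  \<open>exp x \<le> 6 * x\<^sup>2\<close>, that is, up to \<open>L0\<close>. The last two pieces agree at \<open>L0\<close> since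
  \<open>4 * exp L0 = 24 * L0\<^sup>2\<close>.\<close>
definition mgf_exponent :: "real \<Rightarrow> real \<Rightarrow> real \<Rightarrow> real" where
  "mgf_exponent \<gamma> L0 x =
    (if x \<le> 1 / \<gamma> then 5 / 2 * \<gamma>\<^sup>2 * x\<^sup>2 else if x \<le> L0 then 24 * x\<^sup>2 else 4 * exp x)"

text \<open>For \<open>y \<ge> 2\<close> one has \<open>x / y = 1 + (x - y) / y \<le> exp ((x - y) / 2)\<close>; squaring this shows that
  \<open>exp x / x\<^sup>2\<close> increases on \<open>[2, \<infinity>)\<close>.\<close>
lemma exp_div_square_mono:
  fixes x y :: real
  assumes "2 \<le> y" "y \<le> x"
  shows "exp y * x\<^sup>2 \<le> exp x * y\<^sup>2"
proof -
  have "x / y = 1 + (x - y) / y" using assms by (simp add: field_simps)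
  also have "\<dots> \<le> exp ((x - y) / y)" by (rule exp_ge_add_one_self)
  also have "\<dots> \<le> exp ((x - y) / 2)"
    unfolding exp_le_cancel_iff using assms by (intro frac_le) auto
  finally have "(x / y)\<^sup>2 \<le> (exp ((x - y) / 2))\<^sup>2"
    using assms by (intro power_mono) auto
  also have "\<dots> = exp (x - y)" by (simp flip: exp_of_nat_mult)
  finally show ?thesis
    using assms by (simp add: exp_diff power_divide divide_simps mult.commute)
qed

locale tail_constants =
  fixes \<gamma> L0 :: real
  assumes gamma_pos: "\<gamma> > 0" and gamma_eq: "12 / 7 = exp (2 / \<gamma>) - 2 / \<gamma>"
    and L0_eq: "exp L0 = 6 * L0\<^sup>2" and L0_largest: "\<And>L. exp L = 6 * L\<^sup>2 \<Longrightarrow> L \<le> L0"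
begin

lemma gamma_gt_2: "2 < \<gamma>" and gamma_lt: "\<gamma> < 20 / 9"
  using gamma_bounds[OF gamma_pos gamma_eq] .

lemma L0_ge: "5 \<le> L0"
  using L0_ge_5[OF L0_largest] .

lemma inverse_gamma_less_L0: "1 / \<gamma> < L0"
proof -
  have "1 / \<gamma> < 1" using gamma_gt_2 by simp
  then show ?thesis using L0_ge by linarith
qed

lemma gamma_square_le: "5 / 2 * \<gamma>\<^sup>2 \<le> 24"
proof -
  have "\<gamma>\<^sup>2 \<le> (20 / 9)\<^sup>2" using gamma_gt_2 gamma_lt by (intro power_mono) auto
  then show ?thesis by (simp add: power2_eq_square)
qed

lemma mgf_exponent_nonneg: "0 \<le> mgf_exponent \<gamma> L0 x"
  by (simp add: mgf_exponent_def)

lemma square_6_le_exp: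
  assumes "L0 \<le> x"
  shows "6 * x\<^sup>2 \<le> exp x"
proof -
  have "L0\<^sup>2 * (6 * x\<^sup>2) \<le> L0\<^sup>2 * exp x"
    using exp_div_square_mono[of L0 x] L0_ge assms by (simp add: L0_eq mult_ac)
  moreover have "0 < L0\<^sup>2" using L0_ge by simp
  ultimately show ?thesis by simp
qed

text \<open>The exponent divided by \<open>x\<^sup>2\<close> is nondecreasing. So replacing \<open>s\<close> by the image of
  \<open>s\<close> under the transpose of \<open>A\<^sub>i(I\<^sub>n)\<close> costs the squared operator norm as a factor, and the
  sum over \<open>i\<close> produces exactly the quantity that the stochastic order controls.\<close>
lemma mgf_exponent_scale:
  assumes c: "0 \<le> c" "c \<le> 1" and x: "0 \<le> x"
  shows "mgf_exponent \<gamma> L0 (c * x) \<le> c\<^sup>2 * mgf_exponent \<gamma> L0 x"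
proof -
  have cx: "c * x \<le> x" using mult_right_mono[OF c(2) x] by simp
  have le24: "mgf_exponent \<gamma> L0 (c * x) \<le> c\<^sup>2 * (24 * x\<^sup>2)" if "c * x \<le> L0"
    using mult_right_mono[OF gamma_square_le, of "c\<^sup>2 * x\<^sup>2"] that
    by (auto simp: mgf_exponent_def power_mult_distrib mult_ac)
  consider "x \<le> 1 / \<gamma>" | "1 / \<gamma> < x" "x \<le> L0" | "L0 < x" "c * x \<le> L0" | "L0 < x" "L0 < c * x"
    by linarith
  then show ?thesis
  proof cases
    case 1
    then show ?thesis using cx by (auto simp: mgf_exponent_def power_mult_distrib)
  next
    case 2
    then show ?thesis using le24 cx by (auto simp: mgf_exponent_def)
  next
    case 3
    have "c\<^sup>2 * (24 * x\<^sup>2) \<le> c\<^sup>2 * (4 * exp x)"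
      using square_6_le_exp[of x] 3 by (intro mult_left_mono) auto
    also have "4 * exp x = mgf_exponent \<gamma> L0 x"
      using 3 inverse_gamma_less_L0 by (simp add: mgf_exponent_def)
    finally show ?thesis using le24[OF 3(2)] by linarith
  next
    case 4
    have "exp (c * x) * x\<^sup>2 \<le> exp x * (c * x)\<^sup>2"
      using 4 L0_ge cx by (intro exp_div_square_mono) auto
    then have "x\<^sup>2 * exp (c * x) \<le> x\<^sup>2 * (c\<^sup>2 * exp x)"
      by (simp add: power_mult_distrib mult_ac)
    moreover have "0 < x\<^sup>2" using 4 L0_ge by simp
    ultimately have "exp (c * x) \<le> c\<^sup>2 * exp x" by (meson mult_le_cancel_left_pos)
    then show ?thesis using 4 inverse_gamma_less_L0 by (auto simp: mgf_exponent_def)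
  qed
qed

end

section \<open>The toll term against the contraction\<close>

text \<open>Since \<open>exp y - y \<le> exp r - r\<close> for \<open>\<bar>y\<bar> \<le> r\<close>, taking expectations removes the linear
  term and leaves \<open>exp r - r = 1 + O(r\<^sup>2)\<close>.\<close>
lemma (in prob_space) mgf_le_of_centered_bounded:
  assumes [measurable]: "Y \<in> borel_measurable M"
    and bd: "AE \<omega> in M. \<bar>Y \<omega>\<bar> \<le> r" and int: "integrable M Y" "expectation Y = 0"
  shows "(\<integral>\<^sup>+\<omega>. ennreal (exp (Y \<omega>)) \<partial>M) \<le> ennreal (exp r - r)"
proof -
  have ptw: "AE \<omega> in M. exp (Y \<omega>) \<le> exp r - r + Y \<omega>"
    using bd by eventually_elim (use exp_minus_self_mono_abs in fastforce)
  have "(\<integral>\<^sup>+\<omega>. ennreal (exp (Y \<omega>)) \<partial>M) \<le> (\<integral>\<^sup>+\<omega>. ennreal (exp r - r + Y \<omega>) \<partial>M)"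
    using ptw by (intro nn_integral_mono_AE) (auto elim!: eventually_mono intro!: ennreal_leI)
  also have "\<dots> = ennreal (expectation (\<lambda>\<omega>. exp r - r + Y \<omega>))"
    using ptw int by (intro nn_integral_eq_integral) (auto elim!: eventually_mono intro: order.trans[OF exp_ge_zero])
  also have "expectation (\<lambda>\<omega>. exp r - r + Y \<omega>) = exp r - r"
    using int by (simp add: prob_space)
  finally show ?thesis .
qed

text \<open>A form of the Cauchy--Schwarz inequality, needed because the toll and the coefficients
  \<open>A\<^sub>i(I\<^sub>n)\<close> both depend on \<open>I\<^sub>n\<close>. It is derived from
  \<open>p * q \<le> p\<^sup>2 / (2 * P) + P * q\<^sup>2 / 2\<close>, which avoids square roots of possibly infinite
  integrals.\<close>
lemma nn_integral_exp_add_le_1: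
  assumes [measurable]: "Y \<in> borel_measurable M" "V \<in> borel_measurable M"
    and P: "(\<integral>\<^sup>+\<omega>. ennreal (exp (2 * Y \<omega>)) \<partial>M) \<le> ennreal P"
    and Q: "(\<integral>\<^sup>+\<omega>. ennreal (exp (2 * V \<omega>)) \<partial>M) \<le> ennreal Q"
    and PQ: "0 < P" "0 \<le> Q" "P * Q \<le> 1"
  shows "(\<integral>\<^sup>+\<omega>. ennreal (exp (Y \<omega> + V \<omega>)) \<partial>M) \<le> 1"
proof -
  have ptw: "exp (y + v) \<le> 1 / (2 * P) * exp (2 * y) + P / 2 * exp (2 * v)" for y v
  proof -
    have double: "exp (2 * z) = exp z * exp z" for z :: real by (metis exp_add mult_2)
    have "0 \<le> (exp y - P * exp v)\<^sup>2" by simp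
    also have "\<dots> = exp (2 * y) + P\<^sup>2 * exp (2 * v) - 2 * P * exp (y + v)"
      unfolding double exp_add by (simp add: power2_eq_square algebra_simps)
    finally show ?thesis
      using PQ(1) by (simp add: field_simps power2_eq_square)
  qed
  have "(\<integral>\<^sup>+\<omega>. ennreal (exp (Y \<omega> + V \<omega>)) \<partial>M)
      \<le> (\<integral>\<^sup>+\<omega>. ennreal (1 / (2 * P)) * ennreal (exp (2 * Y \<omega>)) + ennreal (P / 2) * ennreal (exp (2 * V \<omega>)) \<partial>M)"
    using ptw PQ(1) by (intro nn_integral_mono) (simp flip: ennreal_mult' ennreal_plus)
  also have "\<dots> = ennreal (1 / (2 * P)) * (\<integral>\<^sup>+\<omega>. ennreal (exp (2 * Y \<omega>)) \<partial>M)
      + ennreal (P / 2) * (\<integral>\<^sup>+\<omega>. ennreal (exp (2 * V \<omega>)) \<partial>M)"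
    by (simp add: nn_integral_add nn_integral_cmult)
  also have "\<dots> \<le> ennreal (1 / (2 * P)) * ennreal P + ennreal (P / 2) * ennreal Q"
    by (intro add_mono mult_left_mono P Q) auto
  also have "\<dots> = ennreal (1 / (2 * P) * P) + ennreal (P / 2 * Q)"
    using PQ(1) by (intro arg_cong2[where f = "(+)"] ennreal_mult'[symmetric]) auto
  also have "\<dots> = ennreal (1 / (2 * P) * P + P / 2 * Q)"
    using PQ by (intro ennreal_plus[symmetric]) auto
  also have "\<dots> \<le> 1"
    using PQ unfolding ennreal_le_1 by (simp add: field_simps)
  finally show ?thesis .
qed

context tail_constants
begin

text \<open>The analytic core: \<open>Y\<close> is the scalar product of \<open>s\<close> with the toll, \<open>W\<close> the sum of squared operator
  norms, and \<open>f\<close> the exponent that the induction has to reproduce. Equivalently,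
  \<open>exp (Y + f * (W - 1))\<close> has expectation at most 1. For large \<open>\<sigma>\<close> it suffices to bound
  \<open>Y\<close> by \<open>\<sigma>\<close> and use \<open>4 * exp \<sigma> \<le> f\<close>. For small \<open>\<sigma>\<close> the vanishing mean of
  \<open>Y\<close> is needed, so the two exponentials are separated by Cauchy--Schwarz.\<close>
lemma mgf_toll_step:
  fixes Y W :: "'a \<Rightarrow> real"
  assumes M: "prob_space M"
    and [measurable]: "Y \<in> borel_measurable M" "W \<in> borel_measurable M"
    and bd: "AE \<omega> in M. \<bar>Y \<omega>\<bar> \<le> \<sigma>" and int: "integrable M Y" "integral\<^sup>L M Y = 0"
    and W: "stoch_le M W unif01 (\<lambda>u. 1 - u * (1 - u))" and \<sigma>: "0 \<le> \<sigma>"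
  defines "f \<equiv> mgf_exponent \<gamma> L0 \<sigma>"
  shows "(\<integral>\<^sup>+\<omega>. ennreal (exp (Y \<omega> + f * W \<omega>)) \<partial>M) \<le> ennreal (exp f)"
proof -
  interpret prob_space M by fact
  have unif: "prob_space unif01"
    by (rule prob_space_uniform_measure) auto
  have V: "(\<integral>\<^sup>+\<omega>. ennreal (exp (a * (W \<omega> - 1))) \<partial>M)
      \<le> (\<integral>\<^sup>+u. ennreal (exp (- (a * (u * (1 - u))))) \<partial>unif01)" if "0 \<le> a" for a
  proof -
    have "(\<integral>\<^sup>+\<omega>. ennreal (exp (a * (W \<omega> - 1))) \<partial>M)
        = ennreal (exp (- a)) * (\<integral>\<^sup>+\<omega>. ennreal (exp (a * W \<omega>)) \<partial>M)"
      by (subst nn_integral_cmult[symmetric])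
        (auto intro!: nn_integral_cong simp: algebra_simps simp flip: ennreal_mult' exp_add)
    also have "\<dots> \<le> ennreal (exp (- a)) * (\<integral>\<^sup>+u. ennreal (exp (a * (1 - u * (1 - u)))) \<partial>unif01)"
      using W that by (intro mult_left_mono stoch_le_mgf_mono M unif) auto
    also have "\<dots> = (\<integral>\<^sup>+u. ennreal (exp (- (a * (u * (1 - u))))) \<partial>unif01)"
      by (subst nn_integral_cmult[symmetric])
        (auto intro!: nn_integral_cong simp: algebra_simps simp flip: ennreal_mult' exp_add)
    finally show ?thesis .
  qed
  have Y2: "(\<integral>\<^sup>+\<omega>. ennreal (exp (2 * Y \<omega>)) \<partial>M) \<le> ennreal (exp (2 * \<sigma>) - 2 * \<sigma>)"
    using bd int by (intro mgf_le_of_centered_bounded) auto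
  have P_pos: "0 < exp (2 * \<sigma>) - 2 * \<sigma>"
    using exp_ge_add_one_self[of "2 * \<sigma>"] by linarith
  have main: "(\<integral>\<^sup>+\<omega>. ennreal (exp (Y \<omega> + f * (W \<omega> - 1))) \<partial>M) \<le> 1"
  proof -
    consider "\<sigma> \<le> 1 / \<gamma>" | "1 / \<gamma> < \<sigma>" "\<sigma> \<le> 11 / 20" | "11 / 20 < \<sigma>" by linarith
    then show ?thesis
    proof cases
      case 1
      \<comment> \<open>The constants \<open>12 / 7\<close> and \<open>5 / 2\<close> are chosen such that the product of the two
        bounds equals 1 at the end point \<open>y = 1\<close>.\<close>
      define y where "y = (\<gamma> * \<sigma>)\<^sup>2"
      have f: "2 * f = 5 * y" using 1 by (simp add: f_def mgf_exponent_def y_def power_mult_distrib)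
      have c: "0 \<le> \<gamma> * \<sigma>" "\<gamma> * \<sigma> \<le> 1" using 1 \<sigma> gamma_pos by (auto simp: field_simps)
      then have y: "0 \<le> y" "y \<le> 1" by (auto simp: y_def power_le_one)
      have P: "exp (2 * \<sigma>) - 2 * \<sigma> \<le> 1 + 5 / 7 * y"
      proof -
        have E: "exp (2 / \<gamma>) - 1 - 2 / \<gamma> = 5 / 7" using gamma_eq by linarith
        have T: "\<gamma> * \<sigma> * (2 / \<gamma>) = 2 * \<sigma>" using gamma_pos by simp
        show ?thesis
          using exp_remainder_scaling[OF c, of "2 / \<gamma>", unfolded E T] gamma_pos
          by (simp add: y_def mult.commute)
      qed
      let ?Q = "1 - 5 * y / 6 + (5 * y)\<^sup>2 / 60"
      show ?thesis
      proof (rule nn_integral_exp_add_le_1)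
        show "(\<integral>\<^sup>+\<omega>. ennreal (exp (2 * Y \<omega>)) \<partial>M) \<le> ennreal (1 + 5 / 7 * y)"
          using Y2 P by (rule order.trans[OF _ ennreal_leI])
        show "(\<integral>\<^sup>+\<omega>. ennreal (exp (2 * (f * (W \<omega> - 1)))) \<partial>M) \<le> ennreal ?Q"
          using order.trans[OF V unif01_mgf_le_quadratic, of "5 * y"] y
          by (simp add: f flip: mult.assoc)
        show "0 \<le> ?Q" using zero_le_power2[of "y - 1"] by (simp add: power2_eq_square algebra_simps)
        have "(1 + 5 / 7 * y) * ?Q = 1 - 5 / 84 * (y * (1 - y) * (2 + 5 * y))"
          by (simp add: field_simps power2_eq_square)
        also have "\<dots> \<le> 1" using y by simp
        finally show "(1 + 5 / 7 * y) * ?Q \<le> 1" .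
      qed (use y in auto)
    next
      case 2
      \<comment> \<open>On this short interval \<open>exp \<sigma> \<le> 6 * \<sigma>\<^sup>2\<close> can fail, but the doubled exponents
        leave room: only \<open>exp (2 * \<sigma>) - 2 * \<sigma> \<le> 12 * \<sigma>\<^sup>2\<close> is needed.\<close>
      have f: "f = 24 * \<sigma>\<^sup>2" using 2 L0_ge by (auto simp: f_def mgf_exponent_def)
      have "9 / 20 < 1 / \<gamma>" using gamma_pos gamma_lt by (simp add: field_simps)
      with 2 have "9 / 20 < \<sigma>" by linarith
      then have sq: "(9 / 20)\<^sup>2 \<le> \<sigma>\<^sup>2" by (intro power_mono) auto
      have "exp (2 * \<sigma>) \<le> exp (2 * (11 / 20))" using 2 by simp
      also have "\<dots> = (exp (11 / 20))\<^sup>2" by (rule exp_double)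
      also have "\<dots> \<le> (1815 / 1000)\<^sup>2" by (intro power_mono exp_11_20_le) auto
      finally have P: "exp (2 * \<sigma>) - 2 * \<sigma> \<le> 12 * \<sigma>\<^sup>2"
        using \<open>9 / 20 < \<sigma>\<close> sq by (simp add: power2_eq_square)
      show ?thesis
      proof (rule nn_integral_exp_add_le_1[OF _ _ Y2 _ P_pos])
        show "(\<integral>\<^sup>+\<omega>. ennreal (exp (2 * (f * (W \<omega> - 1)))) \<partial>M) \<le> ennreal (4 / (2 * f))"
          using order.trans[OF V unif01_mgf_le_inverse, of "2 * f"] \<open>9 / 20 < \<sigma>\<close>
          by (simp add: f mult.assoc)
        show "(exp (2 * \<sigma>) - 2 * \<sigma>) * (4 / (2 * f)) \<le> 1"
          using P \<open>9 / 20 < \<sigma>\<close> by (simp add: f field_simps)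
      qed (auto simp: f)
    next
      case 3
      have f: "0 < f" "4 * exp \<sigma> \<le> f"
      proof -
        have "1 / \<gamma> < 1 / 2" using gamma_gt_2 by (simp add: field_simps)
        with 3 show "4 * exp \<sigma> \<le> f"
          using exp_le_6_square[OF L0_eq L0_largest, of \<sigma>] by (auto simp: f_def mgf_exponent_def)
        then show "0 < f" using exp_gt_zero[of \<sigma>] by linarith
      qed
      have "(\<integral>\<^sup>+\<omega>. ennreal (exp (Y \<omega> + f * (W \<omega> - 1))) \<partial>M)
          \<le> (\<integral>\<^sup>+\<omega>. ennreal (exp \<sigma>) * ennreal (exp (f * (W \<omega> - 1))) \<partial>M)"
        using bd by (intro nn_integral_mono_AE)
          (auto elim!: eventually_mono simp: exp_add simp flip: ennreal_mult')
      also have "\<dots> = ennreal (exp \<sigma>) * (\<integral>\<^sup>+\<omega>. ennreal (exp (f * (W \<omega> - 1))) \<partial>M)"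
        by (simp add: nn_integral_cmult)
      also have "\<dots> \<le> ennreal (exp \<sigma>) * ennreal (4 / f)"
        using f by (intro mult_left_mono order.trans[OF V unif01_mgf_le_inverse]) auto
      also have "\<dots> \<le> 1"
        using f by (simp add: ennreal_le_1 flip: ennreal_mult')
      finally show ?thesis .
    qed
  qed
  have "(\<integral>\<^sup>+\<omega>. ennreal (exp (Y \<omega> + f * W \<omega>)) \<partial>M)
      = ennreal (exp f) * (\<integral>\<^sup>+\<omega>. ennreal (exp (Y \<omega> + f * (W \<omega> - 1))) \<partial>M)"
    by (subst nn_integral_cmult[symmetric])
      (auto intro!: nn_integral_cong simp: algebra_simps simp flip: ennreal_mult' exp_add)
  also have "\<dots> \<le> ennreal (exp f) * 1"
    by (intro mult_left_mono main) auto
  finally show ?thesis by simp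
qed

end

section \<open>One step of the recursion\<close>

lemma norm_transpose_vector_le:
  fixes B :: "real ^ 'k ^ 'k"
  shows "norm (transpose B *v s) \<le> op_norm B * norm s"
proof -
  let ?w = "transpose B *v s"
  have bl: "bounded_linear ((*v) B)" by (rule matrix_vector_mul_bounded_linear)
  have "(norm ?w)\<^sup>2 = s \<bullet> (B *v ?w)"
    by (simp add: dot_lmul_matrix power2_norm_eq_inner)
  also have "\<dots> \<le> norm s * norm (B *v ?w)" by (rule norm_cauchy_schwarz)
  also have "\<dots> \<le> norm s * (op_norm B * norm ?w)"
    unfolding op_norm_def by (intro mult_left_mono onorm[OF bl]) auto
  finally have "norm ?w * norm ?w \<le> (op_norm B * norm s) * norm ?w"
    by (simp add: power2_eq_square mult_ac)
  moreover have "0 \<le> op_norm B"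
    unfolding op_norm_def by (rule onorm_pos_le[OF bl])
  ultimately show ?thesis
    by (cases "norm ?w = 0") auto
qed

lemma UNIV_component: "(UNIV :: 'b component set) = insert Index (insert Noise (range Copy))"
proof -
  have "c \<in> insert Index (insert Noise (range Copy))" for c :: "'b component"
    by (cases c) auto
  then show ?thesis by (intro UNIV_eq_I)
qed

lemma finite_component: "finite (UNIV :: 'b::finite component set)"
  by (simp add: UNIV_component)

lemma prod_component:
  fixes F :: "'b::finite component \<Rightarrow> 'c::comm_monoid_mult"
  shows "prod F UNIV = F Index * F Noise * (\<Prod>i\<in>UNIV. F (Copy i))"
proof -
  have "prod F UNIV = F Index * (F Noise * prod F (range Copy))"
  proof -
    have "finite (range Copy :: 'b component set)" by simp
    moreover have "Index \<notin> insert Noise (range Copy :: 'b component set)"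
      "Noise \<notin> (range Copy :: 'b component set)" by auto
    ultimately have "prod F (insert Index (insert Noise (range Copy))) = F Index * (F Noise * prod F (range Copy))"
      by (metis finite_insert prod.insert)
    then show ?thesis by (simp only: UNIV_component)
  qed
  also have "prod F (range Copy) = (\<Prod>i\<in>UNIV. F (Copy i))"
    by (subst prod.reindex) (auto simp: inj_on_def)
  finally show ?thesis by (simp add: mult.assoc)
qed

text \<open>Real functions of the independent components, collected in one family so that the product rule
  for expectations applies. The index enters only through the event that it equals \<open>v\<close>, and the
  copies only through their members selected by \<open>v\<close>.\<close>
definition component_var ::
  "('b \<Rightarrow> nat \<Rightarrow> 'a \<Rightarrow> real ^ 'k) \<Rightarrow> ('a \<Rightarrow> nat ^ 'b) \<Rightarrow> ('a \<Rightarrow> real ^ 'b)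
   \<Rightarrow> nat ^ 'b \<Rightarrow> ('b \<Rightarrow> real ^ 'k \<Rightarrow> real) \<Rightarrow> (real ^ 'b \<Rightarrow> real) \<Rightarrow> 'b component \<Rightarrow> 'a \<Rightarrow> real" where
  "component_var Xc J Z v g h c \<omega> = (case c of
     Copy i \<Rightarrow> g i (Xc i (v $ i) \<omega>) | Index \<Rightarrow> indicator {v} (J \<omega>) | Noise \<Rightarrow> h (Z \<omega>))"

text \<open>Each \<open>component_var\<close> is a function of one component, so the events it generates are among
  those assumed to be independent.\<close>
lemma (in prob_space) indep_component_var:
  fixes Xc :: "'b::finite \<Rightarrow> nat \<Rightarrow> 'a \<Rightarrow> real ^ 'k"
  assumes indep: "indep_sets (generated_events M Xc J Z) UNIV"
    and J: "J \<in> measurable M (count_space UNIV)"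
    and Z[measurable]: "Z \<in> borel_measurable M"
    and Xc[measurable]: "\<And>i m. Xc i m \<in> borel_measurable M"
    and g[measurable]: "\<And>i. g i \<in> borel_measurable borel" and h[measurable]: "h \<in> borel_measurable borel"
  shows "indep_vars (\<lambda>_. borel) (component_var Xc J Z v g h) UNIV"
  unfolding indep_vars_def2
proof (intro conjI ballI)
  fix c :: "'b component"
  show "component_var Xc J Z v g h c \<in> borel_measurable M"
    unfolding component_var_def
    by (cases c) (auto intro!: measurable_compose[OF J])
next
  show "indep_sets (\<lambda>c. {component_var Xc J Z v g h c -` B \<inter> space M |B. B \<in> sets borel}) UNIV"
  proof (rule indep_sets_mono_sets[OF indep], safe)
    fix c :: "'b component" and B :: "real set"
    assume B[measurable]: "B \<in> sets borel"
    show "component_var Xc J Z v g h c -` B \<inter> space M \<in> generated_events M Xc J Z c"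
    proof (cases c)
      case (Copy i)
      have "(\<lambda>x. g i (x (v $ i))) -` B \<inter> space (PiM UNIV (\<lambda>_. borel)) \<in> sets (PiM UNIV (\<lambda>_. borel))"
        by (rule measurable_sets[OF _ B]) measurable
      then show ?thesis
        by (auto simp: Copy generated_events_def component_var_def space_PiM
            intro!: exI[of _ "(\<lambda>x. g i (x (v $ i))) -` B"])
    next
      case Index
      then show ?thesis
        by (auto simp: generated_events_def component_var_def
            intro!: exI[of _ "(\<lambda>j. indicator {v} j) -` B"])
    next
      case Noise
      have "h -` B \<inter> space borel \<in> sets borel"
        by (rule measurable_sets[OF h B])
      then show ?thesis
        by (auto simp: Noise generated_events_def component_var_def intro!: exI[of _ "h -` B"])
    qed
  qed
qed

text \<open>The copies selected by the fixed vector \<open>v\<close> are independent of index and noise. The factor with index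
  and noise is kept as one integral, because the coefficients and the toll are to be
  recombined over all values \<open>v\<close>.\<close>
lemma (in prob_space) nn_integral_component_product:
  fixes Xc :: "'b::finite \<Rightarrow> nat \<Rightarrow> 'a \<Rightarrow> real ^ 'k"
  assumes indep: "indep_sets (generated_events M Xc J Z) UNIV"
    and J: "J \<in> measurable M (count_space UNIV)"
    and Z: "Z \<in> borel_measurable M"
    and Xc: "\<And>i m. Xc i m \<in> borel_measurable M"
    and g: "\<And>i. g i \<in> borel_measurable borel" and h: "h \<in> borel_measurable borel"
  shows "(\<integral>\<^sup>+\<omega>. indicator {v} (J \<omega>) * ennreal (h (Z \<omega>)) * (\<Prod>i\<in>UNIV. ennreal (g i (Xc i (v $ i) \<omega>))) \<partial>M)
    = (\<integral>\<^sup>+\<omega>. indicator {v} (J \<omega>) * ennreal (h (Z \<omega>)) \<partial>M) * (\<Prod>i\<in>UNIV. \<integral>\<^sup>+\<omega>. ennreal (g i (Xc i (v $ i) \<omega>)) \<partial>M)"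
proof -
  have prod: "(\<integral>\<^sup>+\<omega>. indicator {v} (J \<omega>) * ennreal (h (Z \<omega>)) * (\<Prod>i\<in>UNIV. ennreal (g i (Xc i (v $ i) \<omega>))) \<partial>M)
    = (\<integral>\<^sup>+\<omega>. indicator {v} (J \<omega>) \<partial>M) * (\<integral>\<^sup>+\<omega>. ennreal (h (Z \<omega>)) \<partial>M)
      * (\<Prod>i\<in>UNIV. \<integral>\<^sup>+\<omega>. ennreal (g i (Xc i (v $ i) \<omega>)) \<partial>M)"
    if g: "\<And>i. g i \<in> borel_measurable borel" for g :: "'b \<Rightarrow> real ^ 'k \<Rightarrow> real"
  proof -
    let ?F = "component_var Xc J Z v g h"
    have "(\<integral>\<^sup>+\<omega>. (\<Prod>c\<in>UNIV. ennreal (?F c \<omega>)) \<partial>M) = (\<Prod>c\<in>UNIV. \<integral>\<^sup>+\<omega>. ennreal (?F c \<omega>) \<partial>M)"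
    proof -
      have "indep_vars (\<lambda>_. borel) ?F UNIV"
        by (rule indep_component_var) fact+
      then have "indep_vars (\<lambda>_. borel) (\<lambda>c \<omega>. ennreal (?F c \<omega>)) UNIV"
        by (rule indep_vars_compose2) measurable
      then show ?thesis
        by (rule indep_vars_nn_integral[OF finite_component]) simp
    qed
    then show ?thesis
      by (simp add: prod_component component_var_def ennreal_indicator)
  qed
  \<comment> \<open>The instance with trivial \<open>g\<close> merges index and noise again.\<close>
  show ?thesis
    using prod[OF g] prod[of "\<lambda>_ _. 1"]
    by (simp add: emeasure_space_1)
qed

context tail_constants
begin

text \<open>Condition on the value \<open>v\<close> of the index vector, which ranges over a finite set. Given \<open>v\<close>,
  the exponential moment factorizes, and the hypothesis on the smaller indices together with the
  scaling property of the exponent bounds the contribution of the copies by \<open>exp (f * W v)\<close>.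
  Summing over \<open>v\<close> undoes the conditioning and leaves the expectation of
  \<open>mgf_toll_step\<close>.\<close>
lemma mgf_recursion_step:
  fixes Xc :: "'b::finite \<Rightarrow> nat \<Rightarrow> 'a \<Rightarrow> real ^ 'k"
    and A :: "'b \<Rightarrow> real ^ 'b \<Rightarrow> real ^ 'k ^ 'k"
    and d :: "real ^ 'b \<Rightarrow> real ^ 'b \<Rightarrow> real ^ 'k"
  assumes M: "prob_space M"
    and indep: "prob_space.indep_sets M (generated_events M Xc J Z) UNIV"
    and J[measurable]: "J \<in> measurable M (count_space UNIV)"
    and Z[measurable]: "Z \<in> borel_measurable M"
    and Xc[measurable]: "\<And>i m. Xc i m \<in> borel_measurable M"
    and d[measurable]: "(\<lambda>(x, z). d x z) \<in> borel_measurable (borel \<Otimes>\<^sub>M borel)"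
    and G: "finite G" "AE \<omega> in M. \<forall>i. J \<omega> $ i \<in> G"
    and IH: "\<And>i m s. m \<in> G \<Longrightarrow>
      (\<integral>\<^sup>+\<omega>. ennreal (exp (s \<bullet> Xc i m \<omega>)) \<partial>M) \<le> ennreal (exp (mgf_exponent \<gamma> L0 (norm s * D)))"
    and D: "0 < D" "AE \<omega> in M. norm (d (real_vec (J \<omega>)) (Z \<omega>)) \<le> D"
    and centered: "integrable M (\<lambda>\<omega>. d (real_vec (J \<omega>)) (Z \<omega>))"
      "integral\<^sup>L M (\<lambda>\<omega>. d (real_vec (J \<omega>)) (Z \<omega>)) = 0"
    and A_stoch: "stoch_le M (\<lambda>\<omega>. \<Sum>i\<in>UNIV. (op_norm (A i (real_vec (J \<omega>))))\<^sup>2) unif01 (\<lambda>u. 1 - u * (1 - u))"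
    and A_le: "\<And>i. AE \<omega> in M. op_norm (A i (real_vec (J \<omega>))) \<le> 1"
  shows "(\<integral>\<^sup>+\<omega>. ennreal (exp (s \<bullet> ((\<Sum>i\<in>UNIV. A i (real_vec (J \<omega>)) *v Xc i (J \<omega> $ i) \<omega>)
             + d (real_vec (J \<omega>)) (Z \<omega>)))) \<partial>M)
    \<le> ennreal (exp (mgf_exponent \<gamma> L0 (norm s * D)))"
proof -
  interpret prob_space M by fact
  define f where "f = mgf_exponent \<gamma> L0 (norm s * D)"
  define S where "S = {v :: nat ^ 'b. \<forall>i. v $ i \<in> G}"
  define W where "W v = (\<Sum>i\<in>UNIV. (op_norm (A i (real_vec v)))\<^sup>2)" for v
  define h where "h v z = exp (s \<bullet> d (real_vec v) z)" for v z
  define g where "g v i x = exp ((transpose (A i (real_vec v)) *v s) \<bullet> x)" for v i x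
  have op_nonneg: "0 \<le> op_norm B" for B :: "real ^ 'k ^ 'k"
    unfolding op_norm_def by (intro onorm_pos_le matrix_vector_mul_bounded_linear)
  have finS: "finite S"
  proof (rule finite_subset)
    show "S \<subseteq> (\<lambda>f. \<chi> i. f i) ` (PiE UNIV (\<lambda>_. G))"
      by (auto simp: S_def image_iff intro!: bexI[of _ "vec_nth _"])
    show "finite ((\<lambda>f. \<chi> i. f i) ` (PiE UNIV (\<lambda>_::'b. G)))"
      using G(1) by (intro finite_imageI finite_PiE) auto
  qed
  have JS: "AE \<omega> in M. J \<omega> \<in> S" using G(2) by (simp add: S_def)
  have [measurable]: "h v \<in> borel_measurable borel" for v
  proof -
    have "(\<lambda>z. (\<lambda>(x, z). d x z) (real_vec v, z)) \<in> borel_measurable borel" by measurable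
    then show ?thesis unfolding h_def by measurable
  qed
  have g_meas[measurable]: "g v i \<in> borel_measurable borel" for v i
    unfolding g_def by measurable
  have dJ[measurable]: "(\<lambda>\<omega>. d (real_vec (J \<omega>)) (Z \<omega>)) \<in> borel_measurable M"
    using centered(1) by auto
  have WJ[measurable]: "(\<lambda>\<omega>. W (J \<omega>)) \<in> borel_measurable M"
    by (rule measurable_compose[OF J]) simp
  have Jv[measurable]: "(\<lambda>\<omega>. indicator {v} (J \<omega>) :: ennreal) \<in> borel_measurable M" for v
    by (rule measurable_compose[OF J]) simp
  have split: "exp (s \<bullet> ((\<Sum>i\<in>UNIV. A i (real_vec v) *v Xc i (v $ i) \<omega>) + d (real_vec v) (Z \<omega>)))
      = h v (Z \<omega>) * (\<Prod>i\<in>UNIV. g v i (Xc i (v $ i) \<omega>))" for v \<omega>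
  proof -
    have "s \<bullet> (\<Sum>i\<in>UNIV. A i (real_vec v) *v Xc i (v $ i) \<omega>)
        = (\<Sum>i\<in>UNIV. (transpose (A i (real_vec v)) *v s) \<bullet> Xc i (v $ i) \<omega>)"
      by (simp add: inner_sum_right dot_lmul_matrix)
    then show ?thesis
      by (simp add: h_def g_def inner_add_right exp_add exp_sum mult.commute del: transpose_matrix_vector)
  qed
  have decompose: "(\<integral>\<^sup>+\<omega>. F (J \<omega>) \<omega> \<partial>M) = (\<Sum>v\<in>S. \<integral>\<^sup>+\<omega>. indicator {v} (J \<omega>) * F v \<omega> \<partial>M)"
    if [measurable]: "\<And>v. F v \<in> borel_measurable M" for F :: "nat ^ 'b \<Rightarrow> 'a \<Rightarrow> ennreal"
  proof -
    have "(\<integral>\<^sup>+\<omega>. F (J \<omega>) \<omega> \<partial>M) = (\<integral>\<^sup>+\<omega>. (\<Sum>v\<in>S. indicator {v} (J \<omega>) * F v \<omega>) \<partial>M)"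
    proof (rule nn_integral_cong_AE)
      show "AE \<omega> in M. F (J \<omega>) \<omega> = (\<Sum>v\<in>S. indicator {v} (J \<omega>) * F v \<omega>)"
        using JS
      proof eventually_elim
        case (elim \<omega>)
        have "(\<Sum>v\<in>S. indicator {v} (J \<omega>) * F v \<omega>) = (\<Sum>v\<in>S. if v = J \<omega> then F v \<omega> else 0)"
          by (intro sum.cong) (auto simp: indicator_def)
        then show ?case using elim finS by simp
      qed
    qed
    also have "\<dots> = (\<Sum>v\<in>S. \<integral>\<^sup>+\<omega>. indicator {v} (J \<omega>) * F v \<omega> \<partial>M)"
      by (rule nn_integral_sum) measurable
    finally show ?thesis .
  qed
  have cond: "(\<integral>\<^sup>+\<omega>. indicator {v} (J \<omega>) * ennreal (h v (Z \<omega>) * (\<Prod>i\<in>UNIV. g v i (Xc i (v $ i) \<omega>))) \<partial>M)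
      \<le> (\<integral>\<^sup>+\<omega>. indicator {v} (J \<omega>) * ennreal (exp (s \<bullet> d (real_vec v) (Z \<omega>) + f * W v)) \<partial>M)" for v
  \<comment> \<open>The almost sure assumptions say something about \<open>v\<close> only if \<open>v\<close> is attained with
    positive probability.\<close>
  proof (cases "AE \<omega> in M. J \<omega> \<noteq> v")
    case True
    then have "(\<integral>\<^sup>+\<omega>. indicator {v} (J \<omega>) * ennreal (h v (Z \<omega>) * (\<Prod>i\<in>UNIV. g v i (Xc i (v $ i) \<omega>))) \<partial>M)
        = (\<integral>\<^sup>+\<omega>. 0 \<partial>M)"
      by (intro nn_integral_cong_AE) (auto elim!: eventually_mono)
    then show ?thesis by simp
  next
    case False
    have vG: "v $ i \<in> G" for i
    proof (rule ccontr)
      assume "v $ i \<notin> G"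
      with G(2) have "AE \<omega> in M. J \<omega> \<noteq> v" by (auto elim!: eventually_mono)
      with False show False by simp
    qed
    have op1: "op_norm (A i (real_vec v)) \<le> 1" for i
    proof (rule ccontr)
      assume "\<not> op_norm (A i (real_vec v)) \<le> 1"
      with A_le[of i] have "AE \<omega> in M. J \<omega> \<noteq> v" by (auto elim!: eventually_mono)
      with False show False by simp
    qed
    have mgf_copy: "(\<integral>\<^sup>+\<omega>. ennreal (g v i (Xc i (v $ i) \<omega>)) \<partial>M)
        \<le> ennreal (exp ((op_norm (A i (real_vec v)))\<^sup>2 * f))" for i
    proof -
      let ?w = "transpose (A i (real_vec v)) *v s" and ?o = "op_norm (A i (real_vec v))"
      have "(\<integral>\<^sup>+\<omega>. ennreal (g v i (Xc i (v $ i) \<omega>)) \<partial>M) \<le> ennreal (exp (mgf_exponent \<gamma> L0 (norm ?w * D)))"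
        unfolding g_def by (rule IH[OF vG])
      also have "mgf_exponent \<gamma> L0 (norm ?w * D) \<le> ?o\<^sup>2 * f"
      proof (cases "s = 0")
        case True
        then show ?thesis
          using gamma_pos op_nonneg mgf_exponent_nonneg by (simp add: f_def mgf_exponent_def)
      next
        case False
        define c where "c = norm ?w / norm s"
        have c: "0 \<le> c" "c \<le> ?o"
          using norm_transpose_vector_le[of "A i (real_vec v)" s] False
          by (auto simp: c_def divide_simps)
        have "mgf_exponent \<gamma> L0 (norm ?w * D) = mgf_exponent \<gamma> L0 (c * (norm s * D))"
          using False by (simp add: c_def)
        also have "\<dots> \<le> c\<^sup>2 * f"
          unfolding f_def using c op1[of i] D(1) by (intro mgf_exponent_scale) auto
        also have "\<dots> \<le> ?o\<^sup>2 * f"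
          using c by (intro mult_right_mono power_mono) (auto simp: f_def mgf_exponent_nonneg)
        finally show ?thesis .
      qed
      finally show ?thesis by (simp add: ennreal_leI)
    qed
    have "(\<integral>\<^sup>+\<omega>. indicator {v} (J \<omega>) * ennreal (h v (Z \<omega>) * (\<Prod>i\<in>UNIV. g v i (Xc i (v $ i) \<omega>))) \<partial>M)
      = (\<integral>\<^sup>+\<omega>. indicator {v} (J \<omega>) * ennreal (h v (Z \<omega>)) * (\<Prod>i\<in>UNIV. ennreal (g v i (Xc i (v $ i) \<omega>))) \<partial>M)"
      by (intro nn_integral_cong) (simp add: h_def g_def ennreal_mult' prod_ennreal mult.assoc)
    also have "\<dots> = (\<integral>\<^sup>+\<omega>. indicator {v} (J \<omega>) * ennreal (h v (Z \<omega>)) \<partial>M)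
        * (\<Prod>i\<in>UNIV. \<integral>\<^sup>+\<omega>. ennreal (g v i (Xc i (v $ i) \<omega>)) \<partial>M)"
      by (rule nn_integral_component_product[OF indep J Z Xc]) (auto simp: g_def h_def)
    also have "\<dots> \<le> (\<integral>\<^sup>+\<omega>. indicator {v} (J \<omega>) * ennreal (h v (Z \<omega>)) \<partial>M)
        * (\<Prod>i\<in>UNIV. ennreal (exp ((op_norm (A i (real_vec v)))\<^sup>2 * f)))"
      by (intro mult_left_mono prod_mono_ennreal mgf_copy) auto
    also have "(\<Prod>i\<in>UNIV. ennreal (exp ((op_norm (A i (real_vec v)))\<^sup>2 * f))) = ennreal (exp (f * W v))"
      by (simp add: prod_ennreal W_def sum_distrib_left mult.commute flip: exp_sum)
    also have "(\<integral>\<^sup>+\<omega>. indicator {v} (J \<omega>) * ennreal (h v (Z \<omega>)) \<partial>M) * ennreal (exp (f * W v))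
      = (\<integral>\<^sup>+\<omega>. indicator {v} (J \<omega>) * ennreal (exp (s \<bullet> d (real_vec v) (Z \<omega>) + f * W v)) \<partial>M)"
      by (subst nn_integral_multc[symmetric])
        (auto intro!: nn_integral_cong simp: h_def exp_add ennreal_mult' mult.assoc)
    finally show ?thesis .
  qed
  have dv[measurable]: "(\<lambda>\<omega>. s \<bullet> d (real_vec v) (Z \<omega>)) \<in> borel_measurable M" for v
  proof -
    have "(\<lambda>\<omega>. (\<lambda>(x, z). d x z) (real_vec v, Z \<omega>)) \<in> borel_measurable M" by measurable
    then show ?thesis by simp
  qed
  have "(\<integral>\<^sup>+\<omega>. ennreal (exp (s \<bullet> ((\<Sum>i\<in>UNIV. A i (real_vec (J \<omega>)) *v Xc i (J \<omega> $ i) \<omega>)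
             + d (real_vec (J \<omega>)) (Z \<omega>)))) \<partial>M)
    = (\<Sum>v\<in>S. \<integral>\<^sup>+\<omega>. indicator {v} (J \<omega>) * ennreal (h v (Z \<omega>) * (\<Prod>i\<in>UNIV. g v i (Xc i (v $ i) \<omega>))) \<partial>M)"
    using decompose[of "\<lambda>v \<omega>. ennreal (h v (Z \<omega>) * (\<Prod>i\<in>UNIV. g v i (Xc i (v $ i) \<omega>)))"]
    by (simp add: split)
  also have "\<dots> \<le> (\<Sum>v\<in>S. \<integral>\<^sup>+\<omega>. indicator {v} (J \<omega>) * ennreal (exp (s \<bullet> d (real_vec v) (Z \<omega>) + f * W v)) \<partial>M)"
    by (rule sum_mono) (rule cond)
  also have "\<dots> = (\<integral>\<^sup>+\<omega>. ennreal (exp (s \<bullet> d (real_vec (J \<omega>)) (Z \<omega>) + f * W (J \<omega>))) \<partial>M)"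
    by (rule decompose[of "\<lambda>v \<omega>. ennreal (exp (s \<bullet> d (real_vec v) (Z \<omega>) + f * W v))", symmetric]) measurable
  also have "\<dots> \<le> ennreal (exp f)"
    unfolding f_def
  proof (rule mgf_toll_step[OF M])
    show "AE \<omega> in M. \<bar>s \<bullet> d (real_vec (J \<omega>)) (Z \<omega>)\<bar> \<le> norm s * D"
      using D(2)
    proof eventually_elim
      case (elim \<omega>)
      have "\<bar>s \<bullet> d (real_vec (J \<omega>)) (Z \<omega>)\<bar> \<le> norm s * norm (d (real_vec (J \<omega>)) (Z \<omega>))"
        by (rule Cauchy_Schwarz_ineq2)
      also have "\<dots> \<le> norm s * D" using elim by (intro mult_left_mono) auto
      finally show ?case .
    qed
    show "integrable M (\<lambda>\<omega>. s \<bullet> d (real_vec (J \<omega>)) (Z \<omega>))"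
      using centered(1) by auto
    show "expectation (\<lambda>\<omega>. s \<bullet> d (real_vec (J \<omega>)) (Z \<omega>)) = 0"
      using centered by simp
    show "stoch_le M (\<lambda>\<omega>. W (J \<omega>)) unif01 (\<lambda>u. 1 - u * (1 - u))"
      using A_stoch by (simp add: W_def)
  qed (use D(1) in auto)
  finally show ?thesis by (simp add: f_def)
qed

end

section \<open>From exponential moments to tails\<close>

lemma (in prob_space) chernoff_bound:
  assumes [measurable]: "Y \<in> borel_measurable M" and "0 < l"
    and mgf: "(\<integral>\<^sup>+\<omega>. ennreal (exp (l * Y \<omega>)) \<partial>M) \<le> ennreal (exp K)"
  shows "prob {\<omega> \<in> space M. Y \<omega> > t} \<le> exp (K - l * t)"
proof -
  have "emeasure M {\<omega> \<in> space M. Y \<omega> > t} \<le> emeasure M {\<omega> \<in> space M. Y \<omega> \<ge> t}"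
    by (intro emeasure_mono) auto
  also have "\<dots> \<le> ennreal (exp (- l * t)) * (\<integral>\<^sup>+\<omega>. ennreal (exp (l * Y \<omega>)) * indicator (space M) \<omega> \<partial>M)"
    using \<open>0 < l\<close> by (intro Chernoff_ineq_nn_integral_ge) auto
  also have "(\<integral>\<^sup>+\<omega>. ennreal (exp (l * Y \<omega>)) * indicator (space M) \<omega> \<partial>M) = (\<integral>\<^sup>+\<omega>. ennreal (exp (l * Y \<omega>)) \<partial>M)"
    by (intro nn_integral_cong) simp
  also have "ennreal (exp (- l * t)) * \<dots> \<le> ennreal (exp (- l * t)) * ennreal (exp K)"
    by (intro mult_left_mono mgf) auto
  also have "\<dots> = ennreal (exp (K - l * t))"
    by (simp add: ennreal_mult'[symmetric] exp_add[symmetric])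
  finally show ?thesis by (simp add: emeasure_eq_measure)
qed

context tail_constants
begin

text \<open>Each regime of \<open>tail_bound\<close> is the Chernoff bound for a particular \<open>l\<close>. In the first, third
  and fifth regime \<open>l\<close> minimizes the bound given by one piece of the exponent, and the range of \<open>t\<close>
  is where the minimizer falls into that piece (for the third, where it is at most \<open>L0 / D\<close>). The
  second and fourth regime use the break points \<open>1 / (\<gamma> * D)\<close> and \<open>L0 / D\<close>; their bounds
  hold for every \<open>t\<close>. The constant \<open>C\<close> is the larger of the two points where the second bound
  equals the third.\<close>
lemma tail_bound_of_chernoff:
  assumes D: "0 < D" and t: "0 < t"
    and p: "\<And>l. 0 < l \<Longrightarrow> p \<le> exp (mgf_exponent \<gamma> L0 (l * D) - l * t)"
  shows "p \<le> tail_bound \<gamma> L0 D t"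
proof -
  have lt4: "p \<le> exp (24 * L0\<^sup>2 - L0 / D * t)"
    using p[of "L0 / D"] D L0_ge inverse_gamma_less_L0 by (simp add: mgf_exponent_def)
  have r1: "p \<le> exp (- (t\<^sup>2 / (10 * \<gamma>\<^sup>2 * D\<^sup>2)))" if "t \<le> 5 * \<gamma> * D"
  proof -
    let ?l = "t / (5 * \<gamma>\<^sup>2 * D\<^sup>2)"
    have "?l * D \<le> 1 / \<gamma>" using that D gamma_pos by (simp add: field_simps power2_eq_square)
    then have "mgf_exponent \<gamma> L0 (?l * D) - ?l * t = 5 / 2 * \<gamma>\<^sup>2 * (?l * D)\<^sup>2 - ?l * t"
      by (simp add: mgf_exponent_def)
    also have "\<dots> = - (t\<^sup>2 / (10 * \<gamma>\<^sup>2 * D\<^sup>2))"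
      using D gamma_pos by (simp add: field_simps power2_eq_square)
    finally show ?thesis using p[of ?l] D t gamma_pos by simp
  qed
  have r2: "p \<le> exp (5 / 2 - t / (\<gamma> * D))"
    using p[of "1 / (\<gamma> * D)"] D gamma_pos by (simp add: mgf_exponent_def power_divide)
  have r3: "p \<le> exp (- (t\<^sup>2 / (96 * D\<^sup>2)))" if "t \<le> 48 * D * L0"
  proof -
    let ?l = "t / (48 * D\<^sup>2)"
    have "?l * D \<le> L0" using that D by (simp add: field_simps power2_eq_square)
    then have "mgf_exponent \<gamma> L0 (?l * D) - ?l * t \<le> 24 * (?l * D)\<^sup>2 - ?l * t"
      using mult_right_mono[OF gamma_square_le, of "(?l * D)\<^sup>2"] by (simp add: mgf_exponent_def)
    also have "\<dots> = - (t\<^sup>2 / (96 * D\<^sup>2))"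
      using D by (simp add: field_simps power2_eq_square)
    finally have "exp (mgf_exponent \<gamma> L0 (?l * D) - ?l * t) \<le> exp (- (t\<^sup>2 / (96 * D\<^sup>2)))"
      by simp
    then show ?thesis using p[of ?l] D t by (meson divide_pos_pos mult_pos_pos order.trans zero_less_numeral zero_less_power)
  qed
  have r5: "p \<le> exp (t / D - t / D * ln (t / (4 * D)))" if "4 * D * exp L0 < t"
  proof -
    let ?x = "ln (t / (4 * D))"
    have "exp L0 < t / (4 * D)" using that D by (simp add: field_simps)
    also have "\<dots> = exp ?x" using D t by simp
    finally have x: "L0 < ?x" by simp
    then have "mgf_exponent \<gamma> L0 ?x = 4 * exp ?x"
      using inverse_gamma_less_L0 by (simp add: mgf_exponent_def)
    also have "\<dots> = t / D" using D t by simp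
    finally show ?thesis using p[of "?x / D"] x L0_ge D by (simp add: mult.commute)
  qed
  show ?thesis
    using r1 r2 r3 lt4 r5 by (simp add: tail_bound_def Let_def)
qed

end

lemma eq_in_distr_nn_integral:
  assumes "eq_in_distr M X Y" and f: "f \<in> borel_measurable borel"
  shows "(\<integral>\<^sup>+\<omega>. f (X \<omega>) \<partial>M) = (\<integral>\<^sup>+\<omega>. f (Y \<omega>) \<partial>M)"
proof -
  have [measurable]: "X \<in> borel_measurable M" "Y \<in> borel_measurable M"
    and eq: "distr M borel X = distr M borel Y"
    using assms(1) by (auto simp: eq_in_distr_def)
  have "(\<integral>\<^sup>+\<omega>. f (X \<omega>) \<partial>M) = (\<integral>\<^sup>+x. f x \<partial>distr M borel X)"
    by (rule nn_integral_distr[symmetric]) (use f in auto)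
  also have "\<dots> = (\<integral>\<^sup>+\<omega>. f (Y \<omega>) \<partial>M)"
    unfolding eq by (rule nn_integral_distr) (use f in auto)
  finally show ?thesis .
qed

theorem theorem1p1:
  fixes M :: "'a measure"
    and X :: "nat \<Rightarrow> 'a \<Rightarrow> real ^ 'k"
    and Xc :: "'b::finite \<Rightarrow> nat \<Rightarrow> 'a \<Rightarrow> real ^ 'k"
    and I :: "nat \<Rightarrow> 'a \<Rightarrow> nat ^ 'b"
    and Z :: "'a \<Rightarrow> real ^ 'b"
    and A :: "'b \<Rightarrow> real ^ 'b \<Rightarrow> real ^ 'k ^ 'k"
    and d :: "real ^ 'b \<Rightarrow> real ^ 'b \<Rightarrow> real ^ 'k"
    and D \<gamma> L0 :: real
  assumes "prob_space M"
    and meas_A: "\<And>i. A i \<in> borel_measurable borel"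
    and meas_d: "(\<lambda>(x, z). d x z) \<in> borel_measurable (borel \<Otimes>\<^sub>M borel)"
    and meas_X: "\<And>n. X n \<in> borel_measurable M"
    and meas_I: "\<And>n. n \<ge> 2 \<Longrightarrow> I n \<in> measurable M (count_space UNIV)"
    and range_I: "\<And>n. n \<ge> 2 \<Longrightarrow> AE \<omega> in M. \<forall>i. I n \<omega> $ i < n"
    and meas_Z: "Z \<in> borel_measurable M"
    and range_Z: "AE \<omega> in M. \<forall>i. Z \<omega> $ i \<ge> 0"
    and centered: "\<And>n. n \<ge> 2 \<Longrightarrow>
      integrable M (\<lambda>\<omega>. d (real_vec (I n \<omega>)) (Z \<omega>)) \<and>
      integral\<^sup>L M (\<lambda>\<omega>. d (real_vec (I n \<omega>)) (Z \<omega>)) = 0"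
    and copies: "\<And>i m. eq_in_distr M (Xc i m) (X m)"
    and indep: "\<And>n. n \<ge> 2 \<Longrightarrow>
      prob_space.indep_sets M (generated_events M Xc (I n) Z) UNIV"
    and recursion: "\<And>n. n \<ge> 2 \<Longrightarrow>
      eq_in_distr M (X n)
        (\<lambda>\<omega>. (\<Sum>i\<in>UNIV. A i (real_vec (I n \<omega>)) *v Xc i (I n \<omega> $ i) \<omega>)
             + d (real_vec (I n \<omega>)) (Z \<omega>))"
    and X_0: "(AE \<omega> in M. X 0 \<omega> = 0) \<or> (\<forall>n\<ge>2. AE \<omega> in M. \<forall>i. I n \<omega> $ i \<noteq> 0)"
    and X_1: "AE \<omega> in M. X 1 \<omega> = 0"
    and D_pos: "D > 0"
    and d_bounded: "\<And>n. n \<ge> 2 \<Longrightarrow> AE \<omega> in M. norm (d (real_vec (I n \<omega>)) (Z \<omega>)) \<le> D"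
    and A_stoch: "\<And>n. n \<ge> 2 \<Longrightarrow>
      stoch_le M (\<lambda>\<omega>. \<Sum>i\<in>UNIV. (op_norm (A i (real_vec (I n \<omega>))))\<^sup>2)
               (uniform_measure lborel {0..1::real}) (\<lambda>u. 1 - u * (1 - u))"
    and A_bounded: "\<And>n i. n \<ge> 2 \<Longrightarrow> AE \<omega> in M. op_norm (A i (real_vec (I n \<omega>))) \<le> 1"
    and gamma: "\<gamma> > 0" "12 / 7 = exp (2 / \<gamma>) - 2 / \<gamma>"
    and L0: "exp L0 = 6 * L0\<^sup>2" "\<And>L. exp L = 6 * L\<^sup>2 \<Longrightarrow> L \<le> L0"
  shows "\<forall>t>0. \<forall>n\<ge>1. \<forall>j.
    measure M {\<omega> \<in> space M. X n \<omega> $ j > t} \<le> tail_bound \<gamma> L0 D t \<and>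
    measure M {\<omega> \<in> space M. X n \<omega> $ j < - t} \<le> tail_bound \<gamma> L0 D t"
proof -
  interpret prob_space M by fact
  interpret tail_constants \<gamma> L0 using gamma L0 by unfold_locales
  \<comment> \<open>The indices at which the induction hypothesis is available: \<open>X 0\<close> is either null or never
    selected by the recursion.\<close>
  define good where "good m \<longleftrightarrow> 1 \<le> m \<or> (AE \<omega> in M. X 0 \<omega> = 0)" for m :: nat
  have Xc_meas: "Xc i m \<in> borel_measurable M" for i m
    using copies[of i m] by (simp add: eq_in_distr_def)
  have mgf: "(\<integral>\<^sup>+\<omega>. ennreal (exp (s \<bullet> X n \<omega>)) \<partial>M) \<le> ennreal (exp (mgf_exponent \<gamma> L0 (norm s * D)))"
    if "good n" for n s
    using that
  proof (induction n arbitrary: s rule: less_induct)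
    case (less n)
    show ?case
    proof (cases "2 \<le> n")
      case False
      then have "n = 0 \<or> n = 1" by auto
      then have "AE \<omega> in M. X n \<omega> = 0"
        using less.prems X_1 by (auto simp: good_def)
      then have "(\<integral>\<^sup>+\<omega>. ennreal (exp (s \<bullet> X n \<omega>)) \<partial>M) = (\<integral>\<^sup>+\<omega>. 1 \<partial>M)"
        by (intro nn_integral_cong_AE) (auto elim!: eventually_mono)
      also have "\<dots> = ennreal (exp 0)" by (simp add: emeasure_space_1)
      also have "\<dots> \<le> ennreal (exp (mgf_exponent \<gamma> L0 (norm s * D)))"
        unfolding ennreal_le_iff[OF exp_ge_zero] exp_le_cancel_iff by (rule mgf_exponent_nonneg)
      finally show ?thesis .
    next
      case True
      define G where "G = {m. m < n \<and> good m}"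
      have "(\<integral>\<^sup>+\<omega>. ennreal (exp (s \<bullet> X n \<omega>)) \<partial>M) =
        (\<integral>\<^sup>+\<omega>. ennreal (exp (s \<bullet> ((\<Sum>i\<in>UNIV. A i (real_vec (I n \<omega>)) *v Xc i (I n \<omega> $ i) \<omega>)
             + d (real_vec (I n \<omega>)) (Z \<omega>)))) \<partial>M)"
        by (rule eq_in_distr_nn_integral[OF recursion[OF True]]) measurable
      also have "\<dots> \<le> ennreal (exp (mgf_exponent \<gamma> L0 (norm s * D)))"
      proof (rule mgf_recursion_step[OF \<open>prob_space M\<close> indep meas_I meas_Z Xc_meas meas_d])
        show "finite G" by (simp add: G_def)
        show "AE \<omega> in M. \<forall>i. I n \<omega> $ i \<in> G"
        proof (cases "AE \<omega> in M. X 0 \<omega> = 0")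
          case True
          then show ?thesis using range_I[OF \<open>2 \<le> n\<close>] by (simp add: G_def good_def)
        next
          case False
          then have "AE \<omega> in M. \<forall>i. I n \<omega> $ i \<noteq> 0" using X_0 \<open>2 \<le> n\<close> by blast
          with range_I[OF \<open>2 \<le> n\<close>] show ?thesis
            by eventually_elim (auto simp: G_def good_def Suc_le_eq)
        qed
        show "(\<integral>\<^sup>+\<omega>. ennreal (exp (s \<bullet> Xc i m \<omega>)) \<partial>M) \<le> ennreal (exp (mgf_exponent \<gamma> L0 (norm s * D)))"
          if "m \<in> G" for i m s
        proof -
          have "(\<integral>\<^sup>+\<omega>. ennreal (exp (s \<bullet> Xc i m \<omega>)) \<partial>M) = (\<integral>\<^sup>+\<omega>. ennreal (exp (s \<bullet> X m \<omega>)) \<partial>M)"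
            by (rule eq_in_distr_nn_integral[OF copies]) measurable
          also have "\<dots> \<le> ennreal (exp (mgf_exponent \<gamma> L0 (norm s * D)))"
            using that by (intro less.IH) (auto simp: G_def)
          finally show ?thesis .
        qed
      qed (use True D_pos d_bounded[OF True] centered[OF True] A_stoch[OF True] A_bounded[OF True] in auto)
      finally show ?thesis .
    qed
  qed
  have tail: "prob {\<omega> \<in> space M. (u \<bullet> X n \<omega>) > t} \<le> tail_bound \<gamma> L0 D t"
    if "0 < t" "1 \<le> n" "norm u = 1" for t n u
  proof (rule tail_bound_of_chernoff[OF D_pos \<open>0 < t\<close>])
    fix l :: real assume l: "0 < l"
    have [measurable]: "X n \<in> borel_measurable M" by (rule meas_X)
    show "prob {\<omega> \<in> space M. (u \<bullet> X n \<omega>) > t} \<le> exp (mgf_exponent \<gamma> L0 (l * D) - l * t)"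
      using mgf[of n "l *\<^sub>R u"] that l by (intro chernoff_bound) (auto simp: good_def)
  qed
  show ?thesis
  proof (intro allI impI conjI)
    fix t :: real and n :: nat and j :: 'k
    assume tn: "t > 0" "n \<ge> 1"
    show "prob {\<omega> \<in> space M. X n \<omega> $ j > t} \<le> tail_bound \<gamma> L0 D t"
      using tail[OF tn, of "axis j 1"] by (simp add: inner_axis' norm_axis_1)
    show "prob {\<omega> \<in> space M. X n \<omega> $ j < - t} \<le> tail_bound \<gamma> L0 D t"
      using tail[OF tn, of "- axis j 1"] by (simp add: inner_axis' norm_axis_1 less_minus_iff)
  qed
qed

end
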